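(* Suppose $\Phi\subseteq BC_n$ is a Levi subsystem. Then $\Phi$ is equivalent to a direct sum of arbitrarily many type-$A$ irreducible root systems, plus at most a single irreducible root system of type $BC$.
   Context: Let $V=\mathbb{C}^n$ with canonical basis $(e_1,\dots,e_n)$, orthonormal for the scalar product. For a nonempty $I\subseteq\{1,\dots,n\}$ set $A_I=\{e_i-e_j: i\ne j\in I\}$ and $BC_I=\{\pm e_i\pm e_j: i\ne j\in I\}\cup\{\pm e_i,\pm2e_i: i\in I\}$; $BC_n=BC_{\{1,\dots,n\}}$. A root subsystem of $BC_n$ is a subset stable under the orthogonal reflections defined by its elements. A Levi subsystem of $BC_n$ is a root subsystem $\Phi$ with $\mathrm{span}_{\mathbb{C}}(\Phi)\cap BC_n=\Phi$. Two root subsystems of $BC_n$ are equivalent if they lie in the same orbit of the Weyl group $W(BC_n)$ (generated by the orthogonal reflections in the roots of $BC_n$). The direct sums in the statement are unions $\bigcup_kX_{I_k}$ over the parts of a partition $\{1,\dots,n\}=\bigsqcup_kI_k$, where each $X_{I_k}$ is $A_{I_k}$ (type $A$; empty if $|I_k|=1$) or $BC_{I_k}$ (type $BC$). *)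

theory Defs
  imports
    "HOL-Analysis.Analysis"
    "HOL-Algebra.Bij"
    "HOL-Algebra.Generated_Groups"
begin

text \<open>The index set is a finite type \<open>'n\<close>, so that \<open>complex ^ 'n\<close> is the complex vector space of
  dimension \<open>CARD('n)\<close>; its complex-linear span is \<open>vec.span\<close> (the plain \<open>span\<close> is the real one).\<close>

abbreviation basis_vec :: "'n \<Rightarrow> complex ^ 'n" where
  "basis_vec i \<equiv> axis i 1"

text \<open>The Hermitian product is needed because the library's \<open>inner\<close> on \<open>complex ^ 'n\<close> is only
  its real part.\<close>

definition hermitian_product :: "complex ^ 'n \<Rightarrow> complex ^ 'n \<Rightarrow> complex" where
  "hermitian_product v w = (\<Sum>i\<in>UNIV. v $ i * cnj (w $ i))"

definition reflection :: "complex ^ 'n \<Rightarrow> complex ^ 'n \<Rightarrow> complex ^ 'n" where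
  "reflection \<alpha> v = v - (2 * hermitian_product v \<alpha> / hermitian_product \<alpha> \<alpha>) *s \<alpha>"

definition roots_A :: "'n set \<Rightarrow> (complex ^ 'n) set" where
  "roots_A I = {basis_vec i - basis_vec j | i j. i \<in> I \<and> j \<in> I \<and> i \<noteq> j}"

definition roots_BC :: "'n set \<Rightarrow> (complex ^ 'n) set" where
  "roots_BC I =
     {s *s basis_vec i + t *s basis_vec j | s t i j.
        s \<in> {1, -1} \<and> t \<in> {1, -1} \<and> i \<in> I \<and> j \<in> I \<and> i \<noteq> j}
     \<union> {c *s basis_vec i | c i. c \<in> {1, -1, 2, -2} \<and> i \<in> I}"

definition root_subsystem :: "(complex ^ 'n) set \<Rightarrow> bool" where
  "root_subsystem \<Phi> \<longleftrightarrow>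
     \<Phi> \<subseteq> roots_BC UNIV \<and> (\<forall>\<alpha>\<in>\<Phi>. reflection \<alpha> ` \<Phi> \<subseteq> \<Phi>)"

definition levi_subsystem :: "(complex ^ 'n) set \<Rightarrow> bool" where
  "levi_subsystem \<Phi> \<longleftrightarrow> root_subsystem \<Phi> \<and> vec.span \<Phi> \<inter> roots_BC UNIV = \<Phi>"

definition weyl_group :: "(complex ^ 'n \<Rightarrow> complex ^ 'n) set" where
  "weyl_group = generate (BijGroup UNIV) (reflection ` roots_BC UNIV)"

definition weyl_equivalent :: "(complex ^ 'n) set \<Rightarrow> (complex ^ 'n) set \<Rightarrow> bool" where
  "weyl_equivalent \<Phi> \<Psi> \<longleftrightarrow> (\<exists>w\<in>weyl_group. w ` \<Phi> = \<Psi>)"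

text \<open>The union over the parts of a partition \<open>P\<close>, where \<open>Q\<close> is the set of those parts that carry
  type \<open>BC\<close>; all the other parts carry type \<open>A\<close>.\<close>

definition direct_sum :: "'n set set \<Rightarrow> 'n set set \<Rightarrow> (complex ^ 'n) set" where
  "direct_sum P Q = (\<Union>I\<in>P. if I \<in> Q then roots_BC I else roots_A I)"

end

theory Submission
  imports Defs
begin

text \<open>A Levi subsystem is the set of roots in a subspace \<open>S\<close>, namely its span, so the statement is
  about subspaces. Suppose first that \<open>e\<^sub>i + e\<^sub>j \<in> S\<close> always forces \<open>e\<^sub>i - e\<^sub>j \<in> S\<close>. Then everything
  is controlled by congruence of basis vectors modulo \<open>S\<close>: a root \<open>\<plusminus>(e\<^sub>i - e\<^sub>j)\<close> lies in \<open>S\<close> exactly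
  if \<open>i\<close> and \<open>j\<close> are congruent, while a root \<open>\<plusminus>(e\<^sub>i + e\<^sub>j)\<close> in \<open>S\<close> brings \<open>e\<^sub>i - e\<^sub>j\<close> with it, hence
  both \<open>e\<^sub>i\<close> and \<open>e\<^sub>j\<close>. The indices \<open>i\<close> with \<open>e\<^sub>i \<in> S\<close> form a single congruence class if there are
  any, since all these vectors are congruent to \<open>0\<close>. That class carries type \<open>BC\<close>, and all other
  classes carry type \<open>A\<close> (\<open>roots_in_balanced_subspace\<close>).

  The general case reduces to this one by flipping signs of coordinates. Call two indices linked if
  \<open>e\<^sub>i\<close> is congruent to \<open>e\<^sub>j\<close> or to \<open>- e\<^sub>j\<close>; this is an equivalence relation. Choosing a
  representative in each class, and flipping those \<open>e\<^sub>i\<close> that are not congruent to their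
  representative, makes linked basis vectors congruent (\<open>ex_balancing_sign_change\<close>). Such a sign
  change is a product of reflections in the mutually orthogonal roots \<open>e\<^sub>i\<close>, so it lies in the Weyl
  group.\<close>

section \<open>Roots of type \<open>BC\<close> and \<open>A\<close>\<close>

lemma roots_BC_pairI:
  "s \<in> {1, -1} \<Longrightarrow> t \<in> {1, -1} \<Longrightarrow> i \<in> I \<Longrightarrow> j \<in> I \<Longrightarrow> i \<noteq> j \<Longrightarrow>
     s *s basis_vec i + t *s basis_vec j \<in> roots_BC I"
  and roots_BC_singleI: "c \<in> {1, -1, 2, -2} \<Longrightarrow> i \<in> I \<Longrightarrow> c *s basis_vec i \<in> roots_BC I"
  unfolding roots_BC_def by blast+

lemma roots_BC_E:
  assumes "v \<in> roots_BC I"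
  obtains (pair) s t i j where "v = s *s basis_vec i + t *s basis_vec j"
      "s \<in> {1, -1}" "t \<in> {1, -1}" "i \<in> I" "j \<in> I" "i \<noteq> j"
    | (single) c i where "v = c *s basis_vec i" "c \<in> {1, -1, 2, -2}" "i \<in> I"
  using assms unfolding roots_BC_def by blast

lemma roots_BC_mono: "I \<subseteq> J \<Longrightarrow> roots_BC I \<subseteq> roots_BC J"
  unfolding roots_BC_def by blast

lemma roots_A_subset_roots_BC: "roots_A I \<subseteq> roots_BC I"
proof
  fix v assume "v \<in> roots_A I"
  then obtain i j where "v = 1 *s basis_vec i + (-1) *s basis_vec j" "i \<in> I" "j \<in> I" "i \<noteq> j"
    by (auto simp: roots_A_def)
  then show "v \<in> roots_BC I" by (simp only: roots_BC_pairI insert_iff simp_thms)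
qed

section \<open>Sign changes of coordinates\<close>

definition sign_change :: "'n set \<Rightarrow> complex ^ 'n \<Rightarrow> complex ^ 'n" where
  "sign_change T v = (\<chi> i. if i \<in> T then - v $ i else v $ i)"

lemma sign_change_zero: "sign_change T 0 = 0"
  and sign_change_add: "sign_change T (v + w) = sign_change T v + sign_change T w"
  and sign_change_diff: "sign_change T (v - w) = sign_change T v - sign_change T w"
  and sign_change_scale: "sign_change T (c *s v) = c *s sign_change T v"
  by (simp_all add: sign_change_def vec_eq_iff)

lemma sign_change_basis_vec:
  "sign_change T (basis_vec i) = (if i \<in> T then - basis_vec i else basis_vec i)"
  by (auto simp: sign_change_def vec_eq_iff axis_def)

lemma sign_change_involution: "sign_change T (sign_change T v) = v"
  by (simp add: sign_change_def vec_eq_iff)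

lemma bij_sign_change: "bij (sign_change T)"
  by (rule o_bij[of "sign_change T"]) (auto simp: sign_change_involution)

lemma subspace_vimage_sign_change:
  assumes "vec.subspace S"
  shows "vec.subspace (sign_change T -` S)"
  using vec.subspace_0[OF assms] vec.subspace_add[OF assms] vec.subspace_scale[OF assms]
  by (auto simp: vec.subspace_def sign_change_zero sign_change_add sign_change_scale)

lemma sign_change_image_eq_vimage: "sign_change T ` S = sign_change T -` S"
  by (auto simp: sign_change_involution) (metis imageI sign_change_involution)

lemma sign_change_scaled_basis_vec:
  "sign_change T (c *s basis_vec i) = (if i \<in> T then - c else c) *s basis_vec i"
  by (simp add: sign_change_scale sign_change_basis_vec)

lemma sign_change_mem_roots_BC:
  assumes "v \<in> roots_BC I"
  shows "sign_change T v \<in> roots_BC I"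
  using assms
proof (cases rule: roots_BC_E)
  case (pair s t i j)
  let ?s = "if i \<in> T then - s else s" and ?t = "if j \<in> T then - t else t"
  have "sign_change T v = ?s *s basis_vec i + ?t *s basis_vec j"
    by (simp only: pair(1) sign_change_add sign_change_scaled_basis_vec)
  moreover have "?s *s basis_vec i + ?t *s basis_vec j \<in> roots_BC I"
    by (rule roots_BC_pairI) (use pair in auto)
  ultimately show ?thesis by (simp only:)
next
  case (single c i)
  let ?c = "if i \<in> T then - c else c"
  have "sign_change T v = ?c *s basis_vec i"
    by (simp only: single(1) sign_change_scaled_basis_vec)
  moreover have "?c *s basis_vec i \<in> roots_BC I"
    by (rule roots_BC_singleI) (use single in auto)
  ultimately show ?thesis by (simp only:)
qed

lemma sign_change_vimage_roots_BC: "sign_change T -` roots_BC I = roots_BC I"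
  using sign_change_mem_roots_BC by (auto, metis sign_change_involution)

lemma reflection_basis_vec: "reflection (basis_vec i :: complex ^ 'n::finite) = sign_change {i}"
proof
  fix v :: "complex ^ 'n"
  have cnj_delta: "cnj (if i = k then 1 else 0) = (if i = k then 1 else 0)" for k by simp
  have "hermitian_product v (basis_vec i) = v $ i"
    and "hermitian_product (basis_vec i :: complex ^ 'n) (basis_vec i) = 1"
    by (simp_all add: hermitian_product_def axis_def cnj_delta if_distrib cong: if_cong)
  then show "reflection (basis_vec i) v = sign_change {i} v"
    by (simp add: reflection_def sign_change_def vec_eq_iff axis_def)
qed

lemma mult_BijGroup_UNIV:
  assumes "bij f" and "bij g"
  shows "f \<otimes>\<^bsub>BijGroup UNIV\<^esub> g = f \<circ> g"
  using assms by (simp add: BijGroup_def Bij_def compose_def fun_eq_iff)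

text \<open>Reflecting in \<open>e\<^sub>i\<close> negates the \<open>i\<close>-th coordinate only, so composing these reflections over
  \<open>i \<in> T\<close> negates exactly the coordinates in \<open>T\<close>.\<close>

lemma sign_change_in_weyl_group: "sign_change (T :: 'n::finite set) \<in> weyl_group"
proof -
  have "finite T" by simp
  then show ?thesis
  proof (induction T rule: finite_induct)
    case empty
    have "sign_change ({} :: 'n set) = \<one>\<^bsub>BijGroup UNIV\<^esub>"
      by (simp add: BijGroup_def sign_change_def fun_eq_iff)
    then show ?case by (simp add: weyl_group_def generate.one)
  next
    case (insert i T)
    have "1 *s basis_vec i \<in> roots_BC (UNIV :: 'n set)"
      by (rule roots_BC_singleI) auto
    then have "sign_change {i} \<in> weyl_group"
      unfolding weyl_group_def
      by (intro generate.incl) (metis image_eqI reflection_basis_vec vec.scale_one)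
    then have "sign_change {i} \<otimes>\<^bsub>BijGroup UNIV\<^esub> sign_change T \<in> weyl_group"
      using insert.IH unfolding weyl_group_def by (rule generate.eng)
    moreover have "sign_change (insert i T) = sign_change {i} \<circ> sign_change T"
      using insert.hyps by (auto simp: sign_change_def fun_eq_iff vec_eq_iff)
    ultimately show ?case
      by (simp only: mult_BijGroup_UNIV bij_sign_change)
  qed
qed

section \<open>Choosing the signs\<close>

text \<open>Linkedness is congruence up to sign. Since it does not see signs, replacing basis vectors by
  their negatives does not change it, which is why it can be used to choose the signs.\<close>

definition linked :: "(complex ^ 'n) set \<Rightarrow> ('n \<times> 'n) set" where
  "linked S = {(i, j). basis_vec i - basis_vec j \<in> S \<or> basis_vec i + basis_vec j \<in> S}"

lemma equiv_linked:
  assumes S: "vec.subspace (S :: (complex ^ 'n::finite) set)"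
  shows "equiv UNIV (linked S)"
proof (rule equivI)
  show "refl (linked S)"
    using vec.subspace_0[OF S] by (auto simp: refl_on_def linked_def)
  show "sym (linked S)"
    using vec.subspace_neg[OF S] by (auto simp: sym_def linked_def add.commute) (metis minus_diff_eq)
  show "trans (linked S)"
  proof (rule transI)
    fix i j k
    assume "(i, j) \<in> linked S" and "(j, k) \<in> linked S"
    let ?i = "basis_vec i :: complex ^ 'n" and ?j = "basis_vec j :: complex ^ 'n"
      and ?k = "basis_vec k :: complex ^ 'n"
    \<comment> \<open>one decomposition for each combination of the two signs\<close>
    have "?i - ?k = (?i - ?j) + (?j - ?k)" "?i + ?k = (?i - ?j) + (?j + ?k)"
      "?i - ?k = (?i + ?j) - (?j + ?k)" "?i + ?k = (?i + ?j) - (?j - ?k)"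
      by simp_all
    with \<open>(i, j) \<in> linked S\<close> \<open>(j, k) \<in> linked S\<close> show "(i, k) \<in> linked S"
      unfolding linked_def
      using vec.subspace_add[OF S] vec.subspace_diff[OF S]
      by (smt (verit) case_prodD case_prodI mem_Collect_eq)
  qed
qed simp

text \<open>Only a consistent choice of signs along each class of linked indices is needed. Comparing each
  \<open>e\<^sub>i\<close> with one fixed representative \<open>e\<^sub>r\<close> of its class gives it: after the flip, every
  \<open>e\<^sub>i\<close> of the class becomes congruent to the same vector, the unflipped \<open>e\<^sub>r\<close>.\<close>

lemma ex_balancing_sign_change:
  assumes S: "vec.subspace (S :: (complex ^ 'n::finite) set)"
  shows "\<exists>T. \<forall>i j. basis_vec i + basis_vec j \<in> sign_change T -` S \<longrightarrow>
           basis_vec i - basis_vec j \<in> sign_change T -` S"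
proof -
  define rep where "rep i = (SOME r. r \<in> linked S `` {i})" for i
  have rep: "(i, rep i) \<in> linked S" for i
    unfolding rep_def using someI_ex[of "\<lambda>r. r \<in> linked S `` {i}"]
      equiv_class_self[OF equiv_linked[OF S]]
    by blast
  define T where "T = {i. basis_vec i - basis_vec (rep i) \<notin> S}"
  have to_rep: "sign_change T (basis_vec i) - basis_vec (rep i) \<in> S" for i
  proof (cases "i \<in> T")
    case True
    then have "basis_vec i + basis_vec (rep i) \<in> S"
      using rep[of i] by (auto simp: T_def linked_def)
    then have "- (basis_vec i + basis_vec (rep i)) \<in> S" by (rule vec.subspace_neg[OF S])
    then show ?thesis using True by (simp add: sign_change_basis_vec)
  qed (simp add: sign_change_basis_vec T_def)
  have "sign_change T (basis_vec i - basis_vec j) \<in> S"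
    if sum: "sign_change T (basis_vec i + basis_vec j) \<in> S" for i j
  proof -
    have "(i, j) \<in> linked S"
      using sum vec.subspace_neg[OF S sum]
      by (auto simp: linked_def sign_change_add sign_change_basis_vec add.commute split: if_splits)
    then have "rep i = rep j"
      unfolding rep_def by (simp add: equiv_class_eq[OF equiv_linked[OF S]])
    then have "sign_change T (basis_vec i - basis_vec j)
        = (sign_change T (basis_vec i) - basis_vec (rep i))
          - (sign_change T (basis_vec j) - basis_vec (rep j))"
      by (simp add: sign_change_diff)
    then show ?thesis
      using vec.subspace_diff[OF S to_rep[of i] to_rep[of j]] by simp
  qed
  then show ?thesis by auto
qed

section \<open>Roots in a subspace with balanced signs\<close>

definition congruent_mod :: "(complex ^ 'n) set \<Rightarrow> ('n \<times> 'n) set" where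
  "congruent_mod S = {(i, j). basis_vec i - basis_vec j \<in> S}"

lemma equiv_congruent_mod:
  assumes S: "vec.subspace (S :: (complex ^ 'n::finite) set)"
  shows "equiv UNIV (congruent_mod S)"
proof (rule equivI)
  show "refl (congruent_mod S)"
    using vec.subspace_0[OF S] by (auto simp: refl_on_def congruent_mod_def)
  show "sym (congruent_mod S)"
    using vec.subspace_neg[OF S] by (auto simp: sym_def congruent_mod_def) (metis minus_diff_eq)
  show "trans (congruent_mod S)"
  proof (rule transI)
    fix i j k
    assume "(i, j) \<in> congruent_mod S" and "(j, k) \<in> congruent_mod S"
    then have "(basis_vec i - basis_vec j) + (basis_vec j - basis_vec k) \<in> S"
      unfolding congruent_mod_def by (blast intro: vec.subspace_add[OF S])
    then show "(i, k) \<in> congruent_mod S" by (simp add: congruent_mod_def)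
  qed
qed simp

lemma congruent_class_eq_zero_class:
  assumes S: "vec.subspace S" and i: "basis_vec i \<in> S"
  shows "congruent_mod S `` {i} = {j. basis_vec j \<in> S}"
  using vec.subspace_diff[OF S i] by (force simp: congruent_mod_def)

lemma roots_BC_zero_class_subset:
  assumes S: "vec.subspace S"
  shows "roots_BC {i. basis_vec i \<in> S} \<subseteq> S"
proof
  fix v assume "v \<in> roots_BC {i. basis_vec i \<in> S}"
  then show "v \<in> S"
    using vec.subspace_add[OF S] vec.subspace_scale[OF S]
    by (cases rule: roots_BC_E) (simp_all only: mem_Collect_eq)
qed

lemma mem_subspace_if_sum_and_diff:
  assumes "vec.subspace S" and "v + w \<in> S" and "v - w \<in> S"
  shows "(v :: complex ^ 'n::finite) \<in> S"
proof -
  have "(1/2) *s ((v + w) + (v - w)) \<in> S"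
    by (rule vec.subspace_scale[OF assms(1) vec.subspace_add[OF assms]])
  moreover have "(1/2) *s ((v + w) + (v - w)) = v"
    by (simp add: vec_eq_iff)
  ultimately show ?thesis by simp
qed

text \<open>The set \<open>Z\<close> below consists of the indices \<open>i\<close> with \<open>e\<^sub>i\<close> congruent to \<open>0\<close>. It is a part of the partition
  only if it is inhabited; otherwise no part carries type \<open>BC\<close>, whence the difference with
  \<open>{{}}\<close>. Classes other than \<open>Z\<close> contribute no multiples of basis vectors, and no roots
  \<open>\<plusminus>(e\<^sub>i + e\<^sub>j)\<close> either, because the half sum of \<open>e\<^sub>i + e\<^sub>j\<close> and \<open>e\<^sub>i - e\<^sub>j\<close> is \<open>e\<^sub>i\<close>.\<close>

lemma roots_in_balanced_subspace:
  fixes S :: "(complex ^ 'n::finite) set"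
  defines "Z \<equiv> {i. basis_vec i \<in> S}"
  assumes S: "vec.subspace S"
    and balanced: "\<And>i j. basis_vec i + basis_vec j \<in> S \<Longrightarrow> basis_vec i - basis_vec j \<in> S"
  shows "S \<inter> roots_BC UNIV = direct_sum (UNIV // congruent_mod S) ({Z} - {{}})"
    (is "_ = direct_sum ?P ?Q")
proof (intro equalityI subsetI)
  fix v assume "v \<in> S \<inter> roots_BC UNIV"
  then have "v \<in> S" and "v \<in> roots_BC UNIV" by auto
  from \<open>v \<in> roots_BC UNIV\<close> show "v \<in> direct_sum ?P ?Q"
  proof (cases rule: roots_BC_E)
    case (pair s t i j)
    let ?X = "congruent_mod S `` {i}"
    have sum: "basis_vec i + basis_vec j \<in> S" if "s = t"
      using that pair \<open>v \<in> S\<close> vec.subspace_neg[OF S \<open>v \<in> S\<close>] by (auto simp: add.commute)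
    have "(i, j) \<in> congruent_mod S"
    proof (cases "s = t")
      case True
      then show ?thesis by (simp add: congruent_mod_def balanced sum)
    next
      case False
      then show ?thesis
        using pair \<open>v \<in> S\<close> vec.subspace_neg[OF S \<open>v \<in> S\<close>] by (auto simp: congruent_mod_def)
    qed
    then have ij: "i \<in> ?X" "j \<in> ?X" and diff: "basis_vec i - basis_vec j \<in> S"
      using equiv_class_self[OF equiv_congruent_mod[OF S]] by (auto simp: congruent_mod_def)
    have "v \<in> (if ?X \<in> ?Q then roots_BC ?X else roots_A ?X)"
    proof (cases "s = t")
      case True
      then have "basis_vec i + basis_vec j \<in> S" by (rule sum)
      then have "basis_vec i \<in> S"
        using diff by (rule mem_subspace_if_sum_and_diff[OF S])
      then have "?X = Z"
        unfolding Z_def by (rule congruent_class_eq_zero_class[OF S])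
      with ij have Q: "?X \<in> ?Q" by auto
      show ?thesis
        unfolding if_P[OF Q] pair(1) using pair(2,3,6) ij by (intro roots_BC_pairI)
    next
      case False
      then have "v = basis_vec i - basis_vec j \<or> v = basis_vec j - basis_vec i"
        using pair by auto
      then have "v \<in> roots_A ?X"
        using ij pair(6) unfolding roots_A_def by blast
      with roots_A_subset_roots_BC[of ?X] show ?thesis
        by (subst if_split) blast
    qed
    then show ?thesis
      unfolding direct_sum_def by (blast intro: quotientI)
  next
    case (single c i)
    let ?X = "congruent_mod S `` {i}"
    have "inverse c *s v = basis_vec i"
      using single by auto
    then have "basis_vec i \<in> S"
      using vec.subspace_scale[OF S \<open>v \<in> S\<close>] by metis
    then have "?X = Z" and "i \<in> Z"
      unfolding Z_def using congruent_class_eq_zero_class[OF S] by auto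
    then have Q: "?X \<in> ?Q" and "i \<in> ?X" by blast+
    then have "v \<in> (if ?X \<in> ?Q then roots_BC ?X else roots_A ?X)"
      unfolding if_P[OF Q] single(1) using single(2) by (intro roots_BC_singleI)
    then show ?thesis
      unfolding direct_sum_def by (blast intro: quotientI)
  qed
next
  fix v assume "v \<in> direct_sum ?P ?Q"
  then obtain X where X: "X \<in> ?P" "v \<in> (if X \<in> ?Q then roots_BC X else roots_A X)"
    unfolding direct_sum_def by blast
  show "v \<in> S \<inter> roots_BC UNIV"
  proof (cases "X \<in> ?Q")
    case True
    then have "v \<in> roots_BC Z"
      using X(2) unfolding if_P[OF True] by blast
    moreover from this have "v \<in> S"
      unfolding Z_def by (rule roots_BC_zero_class_subset[OF S, THEN subsetD])
    ultimately show ?thesis using roots_BC_mono[of Z UNIV] by blast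
  next
    case False
    then have A: "v \<in> roots_A X"
      using X(2) by (simp only: if_False)
    then obtain i j where v: "v = basis_vec i - basis_vec j" "i \<in> X" "j \<in> X"
      unfolding roots_A_def by blast
    have "(i, j) \<in> congruent_mod S"
      using in_quotient_imp_in_rel[OF equiv_congruent_mod[OF S] X(1)] v by simp
    then have "v \<in> S" using v by (simp add: congruent_mod_def)
    moreover have "v \<in> roots_BC UNIV"
      using A roots_A_subset_roots_BC roots_BC_mono[of X UNIV] by blast
    ultimately show ?thesis by blast
  qed
qed

theorem corollary9p2p3:
  fixes \<Phi> :: "(complex ^ 'n::finite) set"
  assumes "levi_subsystem \<Phi>"
  shows "\<exists>P Q. partition_on (UNIV :: 'n set) P \<and> Q \<subseteq> P \<and> card Q \<le> 1 \<and>
           weyl_equivalent \<Phi> (direct_sum P Q)"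
proof -
  let ?S = "vec.span \<Phi>"
  obtain T where T: "\<And>i j. basis_vec i + basis_vec j \<in> sign_change T -` ?S \<Longrightarrow>
      basis_vec i - basis_vec j \<in> sign_change T -` ?S"
    using ex_balancing_sign_change[OF vec.subspace_span] by metis
  define S where "S = sign_change T -` ?S"
  define Z where "Z = {i. basis_vec i \<in> S}"
  have S: "vec.subspace S"
    unfolding S_def by (rule subspace_vimage_sign_change[OF vec.subspace_span])
  \<comment> \<open>A Levi subsystem consists of all roots in its span, and a sign change is an involution
    permuting the roots; so the image consists of all roots in the image of the span.\<close>
  have "sign_change T ` \<Phi> = sign_change T -` (?S \<inter> roots_BC UNIV)"
    using assms by (simp add: sign_change_image_eq_vimage levi_subsystem_def)
  also have "\<dots> = S \<inter> roots_BC UNIV"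
    by (simp add: S_def vimage_Int sign_change_vimage_roots_BC)
  also have "\<dots> = direct_sum (UNIV // congruent_mod S) ({Z} - {{}})"
    unfolding Z_def using S T unfolding S_def by (rule roots_in_balanced_subspace)
  finally have "weyl_equivalent \<Phi> (direct_sum (UNIV // congruent_mod S) ({Z} - {{}}))"
    unfolding weyl_equivalent_def using sign_change_in_weyl_group by blast
  moreover have "partition_on UNIV (UNIV // congruent_mod S)"
    by (rule partition_on_quotient[OF equiv_congruent_mod[OF S]])
  moreover have "{Z} - {{}} \<subseteq> UNIV // congruent_mod S"
    using congruent_class_eq_zero_class[OF S]
    by (auto simp: Z_def) (metis UNIV_I quotientI)
  moreover have "card ({Z} - {{}}) \<le> 1"
    by (rule order_trans[OF card_mono[of "{Z}"]]) auto
  ultimately show ?thesis by blast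
qed

end
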